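(* $\mathcal{S}_\omega\le_K nwd$.
   Context: Equip $2^\omega$ with the Haar measure. $\Omega$ is the countable set of clopen subsets of $2^\omega$ of measure $\frac12$, $\Omega_n$ the set of clopen subsets of measure $\frac1{2^n}$. $\mathcal{S}^+_n=\{A\subseteq\Omega:(\forall V\in\Omega_n)(\exists U\in A)(U\cap V=\emptyset)\}$, $\mathcal{S}^+_\omega=\bigcup_n\mathcal{S}^+_n$, and $\mathcal{S}_\omega=\mathcal{P}(\Omega)\setminus\mathcal{S}^+_\omega$, an ideal on $\Omega$. $nwd$ is the ideal of nowhere dense subsets of the rationals $\mathbb{Q}$. For ideals $\mathcal{I}$ on $X$ and $\mathcal{J}$ on $Y$, $\mathcal{I}\le_K\mathcal{J}$ (Katětov) means there is a function $f:Y\to X$ with $f^{-1}[A]\in\mathcal{J}$ for every $A\in\mathcal{I}$. *)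

theory Defs
  imports "HOL-Probability.Probability"
begin

type_synonym cantor = "nat \<Rightarrow> bool"

text \<open>\<open>2\<^sup>\<omega>\<close> is the group \<open>(\<int>/2)\<^sup>\<omega>\<close>, written additively as pointwise exclusive or. It carries the
  topology of the type \<open>nat \<Rightarrow> bool\<close>, i.e. the product of discrete spaces. Its normalised
  Haar measure is the product of the uniform measures on the factors.\<close>

definition haar :: "cantor measure" where
  "haar = PiM UNIV (\<lambda>_. uniform_count_measure UNIV)"

instance bool :: second_countable_topology
proof
  have "open = generate_topology (UNIV :: bool set set)"
    by (auto simp: fun_eq_iff Topological_Spaces.open_discrete intro: generate_topology.Basis)
  then show "\<exists>B :: bool set set. countable B \<and> open = generate_topology B"
    by (intro exI[of _ UNIV]) simp
qed

lemma space_haar [simp]: "space haar = UNIV"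
  by (simp add: haar_def space_PiM space_uniform_count_measure)

lemma sets_haar [simp]: "sets haar = sets borel"
proof -
  have "sets (borel :: bool measure) = UNIV"
    by (intro UNIV_eq_I[symmetric] borel_open Topological_Spaces.open_discrete)
  then have "sets haar = sets (PiM UNIV (\<lambda>_::nat. borel :: bool measure))"
    unfolding haar_def by (intro sets_PiM_cong refl) (simp add: sets_uniform_count_measure)
  then show ?thesis
    by (simp add: sets_PiM_equal_borel)
qed

lemma prob_space_coin: "prob_space (uniform_count_measure (UNIV :: bool set))"
  by (rule prob_space_uniform_count_measure) auto

lemma prob_space_haar: "prob_space haar"
  unfolding haar_def by (intro prob_space_PiM prob_space_coin)

lemma haar_translation_invariant:
  fixes a :: cantor
  shows "distr haar haar (\<lambda>x i. x i \<noteq> a i) = haar"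
proof -
  let ?c = "uniform_count_measure (UNIV :: bool set)"
  let ?t = "\<lambda>(x :: cantor) i. x i \<noteq> a i"
  interpret product_prob_space "\<lambda>_. ?c" "UNIV :: nat set"
    by (rule product_prob_spaceI) (rule prob_space_coin)
  have t_meas: "?t \<in> PiM UNIV (\<lambda>_. ?c) \<rightarrow>\<^sub>M PiM UNIV (\<lambda>_. ?c)"
  proof (rule measurable_PiM_single')
    fix i :: nat
    have "(\<lambda>b. b \<noteq> a i) \<in> ?c \<rightarrow>\<^sub>M ?c"
      by (auto simp: measurable_def sets_uniform_count_measure space_uniform_count_measure)
    from measurable_compose[OF measurable_component_singleton[of i UNIV] this]
    show "(\<lambda>x. x i \<noteq> a i) \<in> PiM UNIV (\<lambda>_. ?c) \<rightarrow>\<^sub>M ?c" by simp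
  qed (auto simp: space_PiM space_uniform_count_measure)
  have "distr (PiM UNIV (\<lambda>_. ?c)) (PiM UNIV (\<lambda>_. ?c)) ?t = PiM UNIV (\<lambda>_. ?c)"
  proof (rule PiM_eq)
    fix J :: "nat set" and F :: "nat \<Rightarrow> bool set"
    assume J: "finite J" "J \<subseteq> UNIV" and F: "\<And>j. j \<in> J \<Longrightarrow> F j \<in> sets ?c"
    let ?F = "\<lambda>j. {b. (b \<noteq> a j) \<in> F j}"
    have "?t -` prod_emb UNIV (\<lambda>_. ?c) J (Pi\<^sub>E J F) \<inter> space (PiM UNIV (\<lambda>_. ?c))
        = prod_emb UNIV (\<lambda>_. ?c) J (Pi\<^sub>E J ?F)"
      by (auto simp: prod_emb_def space_PiM space_uniform_count_measure PiE_def Pi_def)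
    moreover have "prod_emb UNIV (\<lambda>_. ?c) J (Pi\<^sub>E J F) \<in> sets (PiM UNIV (\<lambda>_. ?c))"
      using J F by (intro sets_PiM_I) auto
    ultimately have "emeasure (distr (PiM UNIV (\<lambda>_. ?c)) (PiM UNIV (\<lambda>_. ?c)) ?t)
        (prod_emb UNIV (\<lambda>_. ?c) J (Pi\<^sub>E J F)) = emeasure (PiM UNIV (\<lambda>_. ?c)) (prod_emb UNIV (\<lambda>_. ?c) J (Pi\<^sub>E J ?F))"
      using t_meas by (simp add: emeasure_distr)
    also have "\<dots> = (\<Prod>j\<in>J. emeasure ?c (?F j))"
      using J by (intro emeasure_PiM_emb) (auto simp: sets_uniform_count_measure)
    also have "\<dots> = (\<Prod>j\<in>J. emeasure ?c (F j))"
    proof (rule prod.cong)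
      fix j
      have "?F j = (\<lambda>b. b \<noteq> a j) ` F j"
      proof safe
        fix b assume "(b \<noteq> a j) \<in> F j"
        then show "b \<in> (\<lambda>b. b \<noteq> a j) ` F j"
          by (intro image_eqI[where x="b \<noteq> a j"]) auto
      next
        fix b assume "b \<in> F j"
        then show "((b \<noteq> a j) \<noteq> a j) \<in> F j" by (cases "a j") auto
      qed
      then have "card (?F j) = card (F j)"
        by (auto intro!: card_image inj_onI)
      then show "emeasure ?c (?F j) = emeasure ?c (F j)"
        by (simp add: emeasure_uniform_count_measure)
    qed simp
    finally show "emeasure (distr (PiM UNIV (\<lambda>_. ?c)) (PiM UNIV (\<lambda>_. ?c)) ?t)
        (prod_emb UNIV (\<lambda>_. ?c) J (Pi\<^sub>E J F)) = (\<Prod>j\<in>J. emeasure ?c (F j))" .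
  qed simp_all
  then show ?thesis by (simp add: haar_def)
qed

definition clopen_of_measure :: "real \<Rightarrow> cantor set set" where
  "clopen_of_measure r = {U. open U \<and> closed U \<and> measure haar U = r}"

definition Omega :: "cantor set set" where
  "Omega = clopen_of_measure (1 / 2)"

definition Omega_n :: "nat \<Rightarrow> cantor set set" where
  "Omega_n n = clopen_of_measure (1 / 2 ^ n)"

definition S_plus :: "nat \<Rightarrow> cantor set set set" where
  "S_plus n = {A. A \<subseteq> Omega \<and> (\<forall>V\<in>Omega_n n. \<exists>U\<in>A. U \<inter> V = {})}"

definition S_plus_omega :: "cantor set set set" where
  "S_plus_omega = (\<Union>n. S_plus n)"

definition S_omega :: "cantor set set set" where
  "S_omega = Pow Omega - S_plus_omega"

text \<open>The rationals are taken as the subspace \<open>\<rat>\<close> of the real line.\<close>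

definition nowhere_dense_in :: "'a topology \<Rightarrow> 'a set \<Rightarrow> bool" where
  "nowhere_dense_in T A \<longleftrightarrow> A \<subseteq> topspace T \<and> T interior_of (T closure_of A) = {}"

definition nwd :: "real set set" where
  "nwd = {A. nowhere_dense_in (top_of_set \<rat>) A}"

text \<open>\<open>katetov_le X I Y J\<close>: the ideal \<open>I\<close> on \<open>X\<close> is Katetov-below the ideal \<open>J\<close> on \<open>Y\<close>.
  The underlying sets are explicit because they need not exhaust their types.\<close>

definition katetov_le :: "'a set \<Rightarrow> 'a set set \<Rightarrow> 'b set \<Rightarrow> 'b set set \<Rightarrow> bool" where
  "katetov_le X I Y J \<longleftrightarrow> (\<exists>f \<in> Y \<rightarrow> X. \<forall>A\<in>I. f -` A \<inter> Y \<in> J)"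

end

theory Submission
  imports Defs
begin

text \<open>Enumerate the rationals as \<open>r\<^sub>0, r\<^sub>1, \<dots>\<close> and the clopen sets as \<open>V\<^sub>0, V\<^sub>1, \<dots>\<close>, each occurring
  infinitely often. The label \<open>V\<^bsub>\<lfloor>\<surd>2 / \<bar>q - r\<^sub>i\<bar>\<rfloor>\<^esub>\<close> is locally constant in the
  rational \<open>q \<noteq> r\<^sub>i\<close>, because \<open>\<surd>2\<close> is irrational, and every clopen set is the label on open
  intervals arbitrarily close to \<open>r\<^sub>i\<close>. For \<open>q = r\<^sub>m\<close> start with the whole
  space and remove, for \<open>i < m\<close> in turn, the label at \<open>r\<^sub>i\<close> whenever the
  measure stays above \<open>1/2\<close>; let \<open>f q\<close> be a clopen set of measure \<open>1/2\<close> inside the remainder.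
  Near \<open>r\<^sub>k\<close> the first \<open>k\<close> steps are constant and leave measure above \<open>1/2 + 1/2\<^sup>n\<close> for some
  \<open>n\<close>, so every \<open>V \<in> \<Omega>\<^sub>n\<close> is removed at step \<open>k\<close> throughout some open set near \<open>r\<^sub>k\<close>. Hence
  \<open>f\<close> maps somewhere dense sets into \<open>\<S>\<^sup>+\<^sub>n\<close> for some \<open>n\<close>.\<close>

subsection \<open>Cylinders and clopen sets\<close>

definition cylinder :: "nat \<Rightarrow> cantor \<Rightarrow> cantor set" where
  "cylinder n x = {y. \<forall>i<n. y i = x i}"

lemma mem_cylinder_self: "x \<in> cylinder n x"
  by (simp add: cylinder_def)

lemma cylinder_eq: "y \<in> cylinder n x \<Longrightarrow> cylinder n y = cylinder n x"
  by (auto simp: cylinder_def)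

lemma cylinder_antimono: "m \<le> n \<Longrightarrow> cylinder n x \<subseteq> cylinder m x"
  by (auto simp: cylinder_def)

lemma open_cylinder: "open (cylinder n x)"
proof -
  have "open {y :: cantor. y i = x i}" for i
  proof -
    have "open ((\<lambda>y :: cantor. y i) -` {x i})"
      by (intro open_vimage Topological_Spaces.open_discrete continuous_on_product_coordinates)
    then show ?thesis by (simp add: vimage_def)
  qed
  then have "open (\<Inter>i\<in>{..<n}. {y :: cantor. y i = x i})"
    by (intro open_INT) auto
  moreover have "(\<Inter>i\<in>{..<n}. {y. y i = x i}) = cylinder n x"
    by (auto simp: cylinder_def)
  ultimately show ?thesis by simp
qed

lemma finite_range_cylinder: "finite (range (cylinder n))"
proof (rule finite_subset)
  show "range (cylinder n) \<subseteq> (\<lambda>S. cylinder n (\<lambda>i. i \<in> S)) ` Pow {..<n}"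
  proof
    fix C assume "C \<in> range (cylinder n)"
    then obtain x where "C = cylinder n x" by auto
    then have "C = cylinder n (\<lambda>i. i \<in> {i. i < n \<and> x i})"
      by (auto simp: cylinder_def)
    then show "C \<in> (\<lambda>S. cylinder n (\<lambda>i. i \<in> S)) ` Pow {..<n}"
      by (intro image_eqI[where x="{i. i < n \<and> x i}"]) auto
  qed
qed simp

lemma disjoint_range_cylinder: "disjoint (range (cylinder n))"
proof (rule disjointI)
  fix C D assume "C \<in> range (cylinder n)" "D \<in> range (cylinder n)" "C \<noteq> D"
  then show "C \<inter> D = {}" using cylinder_eq by blast
qed

lemma measure_cylinder: "measure haar (cylinder n x) = 1 / 2 ^ n"
proof -
  let ?c = "uniform_count_measure (UNIV :: bool set)"
  interpret product_prob_space "\<lambda>_. ?c" "UNIV :: nat set"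
    by (rule product_prob_spaceI) (rule prob_space_coin)
  have "cylinder n x = prod_emb UNIV (\<lambda>_. ?c) {..<n} (Pi\<^sub>E {..<n} (\<lambda>i. {x i}))"
    by (auto simp: cylinder_def prod_emb_def space_uniform_count_measure PiE_def Pi_def
        extensional_def restrict_def)
  then have "emeasure haar (cylinder n x) = (\<Prod>i<n. emeasure ?c {x i})"
    unfolding haar_def by (simp add: emeasure_PiM_emb sets_uniform_count_measure)
  also have "\<dots> = (\<Prod>i<n. ennreal (1 / 2))"
    by (simp add: emeasure_uniform_count_measure)
  also have "\<dots> = ennreal ((1 / 2) ^ n)"
    by (simp only: prod_constant card_lessThan) (simp add: ennreal_power del: ennreal_half)
  finally show ?thesis by (simp add: measure_def power_one_over)
qed

lemma measure_Union_cylinders: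
  assumes "F \<subseteq> range (cylinder n)"
  shows "measure haar (\<Union>F) = real (card F) / 2 ^ n"
proof -
  interpret prob_space haar by (rule prob_space_haar)
  have "finite F" using assms finite_range_cylinder finite_subset by blast
  have "measure haar (\<Union>F) = (\<Sum>C\<in>F. measure haar C)"
  proof (rule measure_Union')
    show "finite F" by fact
    show "pairwise disjnt F"
      using pairwise_subset[OF disjoint_range_cylinder assms]
      by (simp add: disjoint_def pairwise_def disjnt_def)
    show "C \<in> fmeasurable haar" if "C \<in> F" for C
      using that assms open_cylinder by (auto simp: fmeasurable_eq_sets)
  qed
  also have "\<dots> = (\<Sum>C\<in>F. 1 / 2 ^ n)"
    using assms by (intro sum.cong) (auto simp: measure_cylinder)
  finally show ?thesis by simp
qed

lemma clopen_Union_cylinders: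
  assumes "F \<subseteq> range (cylinder n)"
  shows "open (\<Union>F)" "closed (\<Union>F)"
proof -
  show "open (\<Union>F)" using assms open_cylinder by blast
  \<comment> \<open>Cylinders of one length partition the space, so the complement is the union of
    the remaining ones.\<close>
  have "- \<Union>F = \<Union>(range (cylinder n) - F)"
  proof (intro set_eqI iffI)
    fix x assume "x \<in> - \<Union>F"
    then have "cylinder n x \<notin> F" using mem_cylinder_self by fast
    then show "x \<in> \<Union>(range (cylinder n) - F)"
      by (intro UnionI[of "cylinder n x"]) (simp_all add: mem_cylinder_self)
  next
    fix x assume "x \<in> \<Union>(range (cylinder n) - F)"
    then obtain y where y: "cylinder n y \<notin> F" "x \<in> cylinder n y" by auto
    have "x \<notin> D" if "D \<in> F" for D
    proof
      assume "x \<in> D"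
      with that assms obtain z where "D = cylinder n z" by auto
      with \<open>x \<in> D\<close> y(2) have "D = cylinder n y" using cylinder_eq by metis
      with that y(1) show False by simp
    qed
    then show "x \<in> - \<Union>F" by simp
  qed
  moreover have "open (\<Union>(range (cylinder n) - F))"
    using open_cylinder by blast
  ultimately show "closed (\<Union>F)" by (simp add: closed_def)
qed

section \<open>Compactness of the Cantor space and its clopen sets\<close>

lemma compact_UNIV_cantor: "compact (UNIV :: cantor set)"
proof -
  have "compact_space (euclidean :: bool topology)"
    by (simp add: compact_space_def finite_imp_compact)
  then have "compact_space (product_topology (\<lambda>_ :: nat. euclidean :: bool topology) UNIV)"
    by (simp add: compact_space_product_topology)
  then show ?thesis
    by (simp add: euclidean_product_topology compact_space_def)
qed

lemma open_contains_cylinder: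
  assumes "open U" "x \<in> U"
  obtains n where "cylinder n x \<subseteq> U"
proof -
  have "openin (product_topology (\<lambda>_ :: nat. euclidean :: bool topology) UNIV) U"
    using assms(1) by (simp add: euclidean_product_topology)
  then obtain X where X: "x \<in> Pi\<^sub>E UNIV X" "finite {i. X i \<noteq> (UNIV :: bool set)}" "Pi\<^sub>E UNIV X \<subseteq> U"
    using product_topology_open_contains_basis[of "\<lambda>_. euclidean" UNIV U x] assms(2) by auto
  obtain n where n: "\<And>i. X i \<noteq> UNIV \<Longrightarrow> i < n"
    using X(2) by (auto simp: finite_nat_set_iff_bounded)
  have "cylinder n x \<subseteq> Pi\<^sub>E UNIV X"
  proof
    fix y assume y: "y \<in> cylinder n x"
    have "y i \<in> X i" for i
    proof (cases "X i = UNIV")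
      case False
      with n y have "y i = x i" by (auto simp: cylinder_def)
      with X(1) show ?thesis by auto
    qed simp
    then show "y \<in> Pi\<^sub>E UNIV X" by auto
  qed
  from this X(3) have "cylinder n x \<subseteq> U" by (rule order_trans)
  then show thesis by (rule that)
qed

text \<open>By compactness finitely many cylinders inside U cover it; refining them to a common
  length keeps them inside U.\<close>

lemma clopen_eq_Union_cylinders:
  assumes "open U" "closed U"
  obtains n where "n > 0" "U = \<Union>(cylinder n ` U)"
proof -
  have "compact U"
    using compact_Int_closed[OF compact_UNIV_cantor assms(2)] by simp
  obtain N where N: "\<And>x. x \<in> U \<Longrightarrow> cylinder (N x) x \<subseteq> U"
    using open_contains_cylinder[OF assms(1)] by meson
  have "U \<subseteq> (\<Union>x\<in>U. cylinder (N x) x)"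
    using mem_cylinder_self by fast
  then obtain T where T: "T \<subseteq> U" "finite T" "U \<subseteq> (\<Union>x\<in>T. cylinder (N x) x)"
    by (rule compactE_image[OF \<open>compact U\<close> open_cylinder])
  obtain n where n: "\<And>x. x \<in> T \<Longrightarrow> N x \<le> n"
    using finite_nat_set_iff_bounded_le[of "N ` T"] T(2) by auto
  \<comment> \<open>\<open>Suc n\<close> makes the length positive, so that half of the space is a
    whole number of cylinders.\<close>
  have "cylinder (Suc n) y \<subseteq> U" if y: "y \<in> U" for y
  proof -
    obtain x where x: "x \<in> T" "y \<in> cylinder (N x) x" using T(3) y by blast
    have "cylinder (Suc n) y \<subseteq> cylinder (N x) y" using n[OF x(1)] by (intro cylinder_antimono) simp
    also have "\<dots> = cylinder (N x) x" using x(2) by (rule cylinder_eq)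
    also have "\<dots> \<subseteq> U" using N T(1) x(1) by blast
    finally show ?thesis .
  qed
  then have "U = \<Union>(cylinder (Suc n) ` U)" using mem_cylinder_self by blast
  then show thesis by (intro that) auto
qed

lemma countable_clopen: "countable {U :: cantor set. open U \<and> closed U}"
proof (rule countable_subset)
  show "{U. open U \<and> closed U} \<subseteq> (\<Union>n. Union ` Pow (range (cylinder n)))"
  proof
    fix U :: "cantor set" assume "U \<in> {U. open U \<and> closed U}"
    then obtain n where "U = \<Union>(cylinder n ` U)"
      using clopen_eq_Union_cylinders by blast
    then show "U \<in> (\<Union>n. Union ` Pow (range (cylinder n)))" by blast
  qed
  have "finite (Union ` Pow (range (cylinder n)))" for n
    using finite_range_cylinder by simp
  then show "countable (\<Union>n. Union ` Pow (range (cylinder n)))"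
    by (intro countable_UN countableI_type countable_finite)
qed

text \<open>Write K as a union of cylinders of length \<open>Suc m\<close>. Their number exceeds
  \<open>2 ^ m\<close>, and any \<open>2 ^ m\<close> of them have total measure 1/2.\<close>

lemma ex_Omega_subset:
  assumes "open K" "closed K" "measure haar K > 1 / 2"
  obtains U where "U \<in> Omega" "U \<subseteq> K"
proof -
  obtain n where n: "n > 0" "K = \<Union>(cylinder n ` K)"
    using clopen_eq_Union_cylinders assms by blast
  then obtain m where m: "n = Suc m" by (cases n) auto
  have "measure haar K = real (card (cylinder n ` K)) / 2 ^ n"
    using measure_Union_cylinders[of "cylinder n ` K" n] n(2) by auto
  with assms(3) have "real (card (cylinder n ` K)) > 2 ^ m"
    by (simp add: m field_simps)
  then have "2 ^ m \<le> card (cylinder n ` K)" by simp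
  then obtain F where F: "F \<subseteq> cylinder n ` K" "card F = 2 ^ m"
    by (rule obtain_subset_with_card_n)
  have F': "F \<subseteq> range (cylinder n)" using F(1) by auto
  have "measure haar (\<Union>F) = 1 / 2"
    using measure_Union_cylinders[OF F'] F(2) by (simp add: m)
  then have "\<Union>F \<in> Omega"
    using clopen_Union_cylinders[OF F'] by (simp add: Omega_def clopen_of_measure_def)
  moreover have "\<Union>F \<subseteq> K" using F(1) n(2) by blast
  ultimately show thesis by (rule that)
qed

lemma clopen_enumeration:
  obtains V :: "nat \<Rightarrow> cantor set"
  where "\<And>m. open (V m)" "\<And>m. closed (V m)"
    "\<And>U N. open U \<Longrightarrow> closed U \<Longrightarrow> \<exists>m\<ge>N. V m = U"
proof -
  let ?C = "{U :: cantor set. open U \<and> closed U}"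
  \<comment> \<open>The first component of the decoded pair names the set. The second is a free
    counter that pushes the code above any bound N.\<close>
  let ?V = "\<lambda>m. from_nat_into ?C (fst (prod_decode m))"
  have "?C \<noteq> {}" using open_empty closed_empty by blast
  then have "?V m \<in> ?C" for m by (rule from_nat_into)
  moreover have "\<exists>m\<ge>N. ?V m = U" if U: "U \<in> ?C" for U N
  proof -
    obtain k where "from_nat_into ?C k = U"
      using from_nat_into_surj[OF countable_clopen U] by blast
    then show ?thesis
      by (intro exI[of _ "prod_encode (k, N)"]) (simp add: le_prod_encode_2)
  qed
  ultimately show thesis by (intro that[of ?V]) auto
qed

subsection \<open>Carving sets out of the Cantor space\<close>

text \<open>The strict test keeps a positive excess of measure over 1/2 at every stage, so sets of
  small enough measure can always be removed next.\<close>

primrec core :: "(nat \<Rightarrow> cantor set) \<Rightarrow> nat \<Rightarrow> cantor set" where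
  "core W 0 = UNIV"
| "core W (Suc k) = (if measure haar (core W k - W k) > 1 / 2 then core W k - W k else core W k)"

lemma clopen_core:
  assumes "\<And>i. open (W i)" "\<And>i. closed (W i)"
  shows "open (core W k)" "closed (core W k)"
  using assms by (induction k) (auto intro: open_Diff closed_Diff)

lemma measure_core: "measure haar (core W k) > 1 / 2"
proof (induction k)
  case 0
  then show ?case using prob_space.prob_space[OF prob_space_haar] by simp
qed auto

lemma core_antimono: "k \<le> m \<Longrightarrow> core W m \<subseteq> core W k"
  by (induction rule: dec_induct) auto

lemma core_cong: "(\<And>i. i < k \<Longrightarrow> W i = W' i) \<Longrightarrow> core W k = core W' k"
  by (induction k) auto

text \<open>By subadditivity, removing \<open>W k\<close> costs at most its measure, which is below
  the excess over 1/2. The test in \<open>core\<close> therefore succeeds.\<close>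

lemma core_Suc_disjoint:
  assumes "open (W k)" "measure haar (W k) < measure haar (core W k) - 1 / 2" "open (core W k)"
  shows "core W (Suc k) \<inter> W k = {}"
proof -
  interpret prob_space haar by (rule prob_space_haar)
  have "prob (core W k) \<le> prob (core W k - W k) + prob (W k)"
  proof -
    have "prob (core W k) \<le> prob ((core W k - W k) \<union> W k)"
      using assms by (intro finite_measure_mono) auto
    also have "\<dots> \<le> prob (core W k - W k) + prob (W k)"
      using assms by (intro measure_Un_le) auto
    finally show ?thesis .
  qed
  with assms(2) show ?thesis by auto
qed

subsection \<open>Labels near a rational\<close>

lemma sqrt_2_not_rat: "sqrt 2 \<notin> \<rat>"
proof
  assume "sqrt 2 \<in> \<rat>"
  then obtain m n :: nat where mn: "n \<noteq> 0" "\<bar>sqrt 2\<bar> = real m / real n" "coprime m n"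
    by (rule Rats_abs_nat_div_natE)
  have "real m = sqrt 2 * real n" using mn(1,2) by (simp add: field_simps)
  then have "real (m\<^sup>2) = real (2 * n\<^sup>2)" by (simp add: power_mult_distrib)
  then have eq: "m\<^sup>2 = 2 * n\<^sup>2" by (simp only: of_nat_eq_iff)
  then have "even (m\<^sup>2)" by simp
  then have "even m" by simp
  then obtain k where "m = 2 * k" by blast
  with eq have "n\<^sup>2 = 2 * k\<^sup>2" by (simp add: power_mult_distrib)
  then have "even (n\<^sup>2)" by simp
  then have "even n" by simp
  with \<open>even m\<close> mn(3) show False by auto
qed

text \<open>At q = p division by zero gives index 0. For rational q the reduction reads only labels
  at \<open>r i\<close> with i < \<open>idx q\<close>, and these points differ from q.\<close>

definition near_index :: "real \<Rightarrow> real \<Rightarrow> nat" where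
  "near_index p q = nat \<lfloor>sqrt 2 / \<bar>q - p\<bar>\<rfloor>"

text \<open>An integer value of the quotient at x would make \<open>sqrt 2\<close> rational, and the
  floor is locally constant away from the integers.\<close>

lemma near_index_locally_constant:
  assumes "p \<in> \<rat>" "x \<in> \<rat>" "x \<noteq> p"
  shows "eventually (\<lambda>q. near_index p q = near_index p x) (nhds x)"
proof -
  have "sqrt 2 / \<bar>x - p\<bar> \<notin> \<int>"
  proof
    assume "sqrt 2 / \<bar>x - p\<bar> \<in> \<int>"
    then have "sqrt 2 / \<bar>x - p\<bar> * \<bar>x - p\<bar> \<in> \<rat>"
      using assms Ints_subset_Rats by (intro Rats_mult) auto
    with assms(3) have "sqrt 2 \<in> \<rat>" by simp
    then show False using sqrt_2_not_rat by simp
  qed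
  moreover have "((\<lambda>q. sqrt 2 / \<bar>q - p\<bar>) \<longlongrightarrow> sqrt 2 / \<bar>x - p\<bar>) (nhds x)"
    using assms(3) by (intro tendsto_intros filterlim_ident) auto
  ultimately have "eventually (\<lambda>q. \<lfloor>sqrt 2 / \<bar>q - p\<bar>\<rfloor> = \<lfloor>sqrt 2 / \<bar>x - p\<bar>\<rfloor>) (nhds x)"
    by (intro eventually_floor_eq)
  then show ?thesis by eventually_elim (simp add: near_index_def)
qed

lemma near_index_hits:
  assumes "d > 0"
  obtains N where "\<And>m. m \<ge> N \<Longrightarrow>
    \<exists>J. open J \<and> J \<noteq> {} \<and> J \<subseteq> ball x d \<and> (\<forall>q\<in>J. near_index x q = m)"
proof -
  obtain N where N: "sqrt 2 / d < real N" using reals_Archimedean2 by blast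
  have "\<exists>J. open J \<and> J \<noteq> {} \<and> J \<subseteq> ball x d \<and> (\<forall>q\<in>J. near_index x q = m)"
    if m: "m \<ge> N" for m
  proof (intro exI conjI ballI)
    \<comment> \<open>To the right of x these are the points whose quotient lies strictly between m
      and m + 1.\<close>
    let ?J = "{x + sqrt 2 / (real m + 1) <..< x + sqrt 2 / real m}"
    have "sqrt 2 / d > 0" using assms by simp
    with N m have m0: "real m > 0" and md: "sqrt 2 / d < real m" by linarith+
    have "sqrt 2 / real m < d" using md m0 assms by (simp add: field_simps)
    show "open ?J" by simp
    have "sqrt 2 / (real m + 1) < sqrt 2 / real m"
      using m0 by (intro divide_strict_left_mono) auto
    then show "?J \<noteq> {}" by simp
    show "?J \<subseteq> ball x d"
    proof
      fix q assume q: "q \<in> ?J"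
      have "sqrt 2 / (real m + 1) > 0" by simp
      moreover have "x + sqrt 2 / (real m + 1) < q" using q by simp
      ultimately have "q > x" by linarith
      with q \<open>sqrt 2 / real m < d\<close> show "q \<in> ball x d" by (auto simp: dist_real_def)
    qed
    fix q assume q: "q \<in> ?J"
    have "sqrt 2 / (real m + 1) > 0" by simp
    moreover have bounds: "sqrt 2 / (real m + 1) < q - x" "q - x < sqrt 2 / real m" using q by auto
    ultimately have pos: "q - x > 0" by linarith
    from bounds have "real m < sqrt 2 / (q - x)" "sqrt 2 / (q - x) < real m + 1"
      using pos m0 by (simp_all add: field_simps)
    then have "\<lfloor>sqrt 2 / (q - x)\<rfloor> = int m" by (intro floor_unique) auto
    then show "near_index x q = m" using pos by (simp add: near_index_def)
  qed
  then show thesis by (rule that)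
qed

text \<open>This moves density from the subspace to real open sets: J contains a rational in the
  closure of B, and the trace of J on the rationals is a neighbourhood of it.\<close>

lemma somewhere_dense_rats:
  assumes "B \<subseteq> \<rat>" "B \<notin> nwd"
  obtains W where "open W" "W \<noteq> {}" "\<And>J. open J \<Longrightarrow> J \<noteq> {} \<Longrightarrow> J \<subseteq> W \<Longrightarrow> J \<inter> B \<noteq> {}"
proof -
  let ?T = "top_of_set (\<rat> :: real set)"
  have "?T interior_of (?T closure_of B) \<noteq> {}"
    using assms by (auto simp: nwd_def nowhere_dense_in_def)
  then obtain G where G: "openin ?T G" "G \<noteq> {}" "G \<subseteq> ?T closure_of B"
    by (metis openin_interior_of interior_of_subset)
  then obtain W where W: "open W" "G = \<rat> \<inter> W" by (auto simp: openin_open)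
  have "J \<inter> B \<noteq> {}" if J: "open J" "J \<noteq> {}" "J \<subseteq> W" for J
  proof -
    obtain z where "z \<in> J" using J(2) by blast
    then obtain e where e: "e > 0" "ball z e \<subseteq> J" using J(1) openE by blast
    obtain y where y: "y \<in> \<rat>" "z < y" "y < z + e"
      using Rats_dense_in_real[of z "z + e"] e(1) by auto
    then have "y \<in> ball z e" by (auto simp: dist_real_def)
    then have "y \<in> J" using e(2) by blast
    then have "y \<in> ?T closure_of B" using J(3) W(2) G(3) y(1) by blast
    moreover have "openin ?T (\<rat> \<inter> J)" using J(1) by (auto simp: openin_open)
    ultimately show ?thesis using \<open>y \<in> J\<close> y(1) unfolding in_closure_of by blast
  qed
  with W G(2) that show thesis by blast
qed

section \<open>Construction and verification of the Katetov reduction\<close>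

theorem theorem3p2:
  shows "katetov_le Omega S_omega \<rat> nwd"
proof -
  obtain V :: "nat \<Rightarrow> cantor set" where V: "\<And>m. open (V m)" "\<And>m. closed (V m)"
    "\<And>U N. open U \<Longrightarrow> closed U \<Longrightarrow> \<exists>m\<ge>N. V m = U"
    using clopen_enumeration by blast
  define idx where "idx = to_nat_on (\<rat> :: real set)"
  define r where "r = from_nat_into (\<rat> :: real set)"
  have infQ: "infinite (\<rat> :: real set)" by (rule Rats_infinite)
  have r_idx: "r (idx q) = q" if "q \<in> \<rat>" for q
    unfolding r_def idx_def by (rule from_nat_into_to_nat_on[OF countable_rat that])
  have idx_r: "idx (r i) = i" for i
    unfolding r_def idx_def by (rule to_nat_on_from_nat_into_infinite[OF countable_rat infQ])
  have r_rat: "r i \<in> \<rat>" for i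
    unfolding r_def by (rule from_nat_into) (use infQ in auto)
  define L where "L q i = V (near_index (r i) q)" for q i
  have L_clopen: "open (L q i)" "closed (L q i)" for q i using V by (simp_all add: L_def)
  define C where "C q k = core (L q) k" for q k
  have C_clopen: "open (C q k)" "closed (C q k)" for q k
    unfolding C_def by (intro clopen_core L_clopen)+
  have "\<exists>U. U \<in> Omega \<and> U \<subseteq> C q (idx q)" for q
    using ex_Omega_subset[OF C_clopen] measure_core unfolding C_def by metis
  then obtain f where f: "\<And>q. f q \<in> Omega" "\<And>q. f q \<subseteq> C q (idx q)" by metis
  have "f -` A \<inter> \<rat> \<in> nwd" if A: "A \<in> S_omega" for A
  proof (rule ccontr)
    assume "f -` A \<inter> \<rat> \<notin> nwd"
    then obtain W where W: "open W" "W \<noteq> {}"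
      "\<And>J. open J \<Longrightarrow> J \<noteq> {} \<Longrightarrow> J \<subseteq> W \<Longrightarrow> J \<inter> (f -` A \<inter> \<rat>) \<noteq> {}"
      using somewhere_dense_rats[of "f -` A \<inter> \<rat>"] by auto
    have "W \<inter> \<rat> \<noteq> {}"
      using W(3)[of W] W(1,2) by blast
    then obtain x where x: "x \<in> W" "x \<in> \<rat>" by blast
    \<comment> \<open>With k the index of x, step k of the carving at nearby rationals of larger
      index uses the labels around x itself.\<close>
    define k where "k = idx x"
    have rk: "r k = x" using x(2) by (simp add: k_def r_idx)
    \<comment> \<open>The points \<open>r i\<close> with i < k differ from x, so the first k labels,
      and hence the set left before step k, are constant near x.\<close>
    have "eventually (\<lambda>q. q \<in> W \<and> (\<forall>i\<in>{..<k}. near_index (r i) q = near_index (r i) x)) (nhds x)"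
    proof (intro eventually_conj eventually_ball_finite ballI)
      show "eventually (\<lambda>q. q \<in> W) (nhds x)" using W(1) x(1) by (rule eventually_nhds_in_open)
      fix i assume "i \<in> {..<k}"
      then have "x \<noteq> r i" using idx_r[of i] by (auto simp: k_def)
      then show "eventually (\<lambda>q. near_index (r i) q = near_index (r i) x) (nhds x)"
        using near_index_locally_constant r_rat x(2) by blast
    qed simp
    then obtain d where d: "d > 0" "\<And>q. q \<in> ball x d \<Longrightarrow> q \<in> W"
      "\<And>q i. q \<in> ball x d \<Longrightarrow> i < k \<Longrightarrow> near_index (r i) q = near_index (r i) x"
      by (auto simp: eventually_nhds_metric dist_commute)
    have C_near: "C q k = C x k" if "q \<in> ball x d" for q
      unfolding C_def using d(3)[OF that] by (intro core_cong) (simp add: L_def)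
    obtain N where N: "\<And>m. m \<ge> N \<Longrightarrow>
        \<exists>J. open J \<and> J \<noteq> {} \<and> J \<subseteq> ball x d \<and> (\<forall>q\<in>J. near_index x q = m)"
      using near_index_hits[OF d(1), of x] by blast
    have "measure haar (C x k) - 1 / 2 > 0" using measure_core by (simp add: C_def)
    \<comment> \<open>The excess belongs to the common set \<open>C x k\<close>, so this n is fixed
      before X and one n serves all of \<open>Omega_n n\<close>.\<close>
    then obtain n where n: "(1 / 2) ^ n < measure haar (C x k) - 1 / 2"
      using real_arch_pow_inv[of "measure haar (C x k) - 1 / 2" "1 / 2"] by auto
    have "\<exists>U\<in>A. U \<inter> X = {}" if "X \<in> Omega_n n" for X
    proof -
      have X: "open X" "closed X" "measure haar X = (1 / 2) ^ n"
        using that by (auto simp: Omega_n_def clopen_of_measure_def power_one_over)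
      \<comment> \<open>Only indices from N on are sure to be attained inside the ball; X recurs in
        the enumeration, so it has such an index.\<close>
      obtain m where m: "m \<ge> N" "V m = X" using V(3)[OF X(1,2)] by blast
      obtain J where J: "open J" "J \<noteq> {}" "J \<subseteq> ball x d" "\<And>q. q \<in> J \<Longrightarrow> near_index x q = m"
        using N[OF m(1)] by blast
      \<comment> \<open>Deleting the first k + 1 rationals forces \<open>idx q > k\<close>, so that
        step k is among those carried out at q. A nonempty open set of reals is infinite, so
        something remains.\<close>
      have "J - r ` {..k} \<noteq> {}"
        using finite_imp_not_open[of J] J(1,2) finite_subset[of J "r ` {..k}"] by auto
      moreover have "open (J - r ` {..k})"
        using J(1) by (intro open_Diff finite_imp_closed) auto
      moreover have "J - r ` {..k} \<subseteq> W" using J(3) d(2) by blast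
      ultimately obtain q where q: "q \<in> J" "q \<notin> r ` {..k}" "f q \<in> A" "q \<in> \<rat>"
        using W(3)[of "J - r ` {..k}"] by blast
      have "idx q > k"
      proof (rule ccontr)
        assume "\<not> idx q > k"
        then have "r (idx q) \<in> r ` {..k}" by auto
        with q(2,4) show False by (simp add: r_idx)
      qed
      have "L q k = X" using J(4)[OF q(1)] m(2) by (simp add: L_def rk)
      moreover have "C q k = C x k" using C_near q(1) J(3) by blast
      \<comment> \<open>X is the label removed at step k, and later steps only shrink the set that
        contains \<open>f q\<close>.\<close>
      ultimately have "C q (Suc k) \<inter> X = {}"
        using core_Suc_disjoint[of "L q" k] C_clopen(1)[of q k] X n by (simp only: C_def)
      moreover have "f q \<subseteq> C q (Suc k)"
        using f(2)[of q] core_antimono[of "Suc k" "idx q" "L q"] \<open>idx q > k\<close>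
        by (auto simp only: C_def Suc_le_eq)
      ultimately show ?thesis using q(3) by blast
    qed
    moreover have "A \<subseteq> Omega" using A by (auto simp: S_omega_def)
    ultimately have "A \<in> S_plus_omega" by (auto simp: S_plus_omega_def S_plus_def)
    with A show False by (simp add: S_omega_def)
  qed
  with f(1) show ?thesis unfolding katetov_le_def by (intro bexI[of _ f]) auto
qed

end
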